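(* Let $\mathcal{H}$ be a complex Hilbert space, let $T\in\mathcal{B}(\mathcal{H})$ and let $q\in[0,1]$. Then $$\omega_q^2(T)\le q^2\,\omega^2(T)+\left(1-q^2+q\sqrt{1-q^2}\right)\|T\|^2-(1-q^2)\,c^2(T).$$
   Context: $\mathcal{B}(\mathcal{H})$ denotes the bounded linear operators on the complex Hilbert space $\mathcal{H}$ and $\|\cdot\|$ the operator norm. The numerical radius and the Crawford number of $T$ are $\omega(T)=\sup\{|\langle Tx,x\rangle| : \|x\|=1\}$ and $c(T)=\inf\{|\langle Tx,x\rangle| : \|x\|=1\}$. For $q\in[0,1]$, the $q$-numerical radius of $T$ is $\omega_q(T)=\sup\{|\langle Tx,y\rangle| : x,y\in\mathcal{H},\ \|x\|=\|y\|=1,\ \langle x,y\rangle=q\}$. Here $\omega^2(T)=(\omega(T))^2$, $\omega_q^2(T)=(\omega_q(T))^2$, $c^2(T)=(c(T))^2$. Suprema and infima over empty sets (which occur only when $\dim\mathcal{H}=0$, or, for $\omega_q$, $\dim\mathcal{H}=1$ and $q<1$) are read as $0$. *)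

theory Defs
  imports "HOL-Analysis.Analysis"
begin

class scaleC =
  fixes scaleC :: "complex \<Rightarrow> 'a \<Rightarrow> 'a"  (infixr "*\<^sub>C" 75)

text \<open>A complex vector space; the real scalar multiplication of the library is the restriction
  of the complex one.\<close>

class complex_vector = real_vector + scaleC +
  assumes scaleC_add_right: "a *\<^sub>C (x + y) = a *\<^sub>C x + a *\<^sub>C y"
    and scaleC_add_left: "(a + b) *\<^sub>C x = a *\<^sub>C x + b *\<^sub>C x"
    and scaleC_scaleC: "a *\<^sub>C (b *\<^sub>C x) = (a * b) *\<^sub>C x"
    and scaleC_one: "1 *\<^sub>C x = x"
    and scaleR_scaleC: "r *\<^sub>R x = complex_of_real r *\<^sub>C x"

text \<open>The inner product is linear in the first and conjugate-linear in the second argument, and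
  the norm is the one it induces. That \<open>cinner x x\<close> is real follows from \<open>cinner_commute\<close>.\<close>

class complex_inner = complex_vector + real_normed_vector +
  fixes cinner :: "'a \<Rightarrow> 'a \<Rightarrow> complex"
  assumes cinner_commute: "cinner x y = cnj (cinner y x)"
    and cinner_add_left: "cinner (x + y) z = cinner x z + cinner y z"
    and cinner_scaleC_left: "cinner (a *\<^sub>C x) y = a * cinner x y"
    and cinner_ge_zero: "0 \<le> Re (cinner x x)"
    and cinner_eq_zero_iff: "cinner x x = 0 \<longleftrightarrow> x = 0"
    and norm_eq_sqrt_cinner: "norm x = sqrt (Re (cinner x x))"

class chilbert_space = complex_inner + complete_space

instantiation complex :: chilbert_space
begin

definition scaleC_complex :: "complex \<Rightarrow> complex \<Rightarrow> complex" where
  "scaleC_complex a x = a * x"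

definition cinner_complex :: "complex \<Rightarrow> complex \<Rightarrow> complex" where
  "cinner_complex x y = x * cnj y"

instance
  by standard
    (auto simp: scaleC_complex_def cinner_complex_def algebra_simps scaleR_conv_of_real
      cmod_def power2_eq_square)

end

text \<open>Bounded complex-linear operators. Their operator norm is the library's \<open>onorm\<close>.\<close>

definition bounded_clinear :: "('a::complex_inner \<Rightarrow> 'b::complex_inner) \<Rightarrow> bool" where
  "bounded_clinear T \<longleftrightarrow> bounded_linear T \<and> (\<forall>a x. T (a *\<^sub>C x) = a *\<^sub>C T x)"

text \<open>\<open>Sup\<close> and \<open>Inf\<close> of the empty set of reals are unspecified in the library; here they are
  read as 0.\<close>

definition Sup0 :: "real set \<Rightarrow> real" where
  "Sup0 S = (if S = {} then 0 else Sup S)"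

definition Inf0 :: "real set \<Rightarrow> real" where
  "Inf0 S = (if S = {} then 0 else Inf S)"

definition numerical_radius :: "('a::complex_inner \<Rightarrow> 'a) \<Rightarrow> real" where
  "numerical_radius T = Sup0 {cmod (cinner (T x) x) | x. norm x = 1}"

definition crawford_number :: "('a::complex_inner \<Rightarrow> 'a) \<Rightarrow> real" where
  "crawford_number T = Inf0 {cmod (cinner (T x) x) | x. norm x = 1}"

definition q_numerical_radius :: "real \<Rightarrow> ('a::complex_inner \<Rightarrow> 'a) \<Rightarrow> real" where
  "q_numerical_radius q T =
    Sup0 {cmod (cinner (T x) y) | x y. norm x = 1 \<and> norm y = 1 \<and> cinner x y = complex_of_real q}"

end

theory Submission
  imports Defs
begin

text \<open>Fix admissible unit vectors \<open>x\<close>, \<open>y\<close>, so \<open>\<langle>x,y\<rangle> = q\<close>, and put \<open>s = sqrt (1 - q\<^sup>2)\<close>. Split both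
  \<open>T x\<close> and \<open>y\<close> into a multiple of \<open>x\<close> and a part orthogonal to \<open>x\<close>. For \<open>y\<close> these parts have norms
  \<open>q\<close> and \<open>s\<close>; for \<open>T x\<close> they have norms \<open>a = \<bar>\<langle>T x,x\<rangle>\<bar>\<close> and \<open>b\<close>, where \<open>a\<^sup>2 + b\<^sup>2 = \<parallel>T x\<parallel>\<^sup>2\<close>. The
  Cauchy--Schwarz inequality on the orthogonal parts (lemma \<open>cmod_cinner_split_le\<close>) gives
  \<open>\<bar>\<langle>T x,y\<rangle>\<bar> \<le> q a + s b\<close>.

  On squaring, the mixed term is at most \<open>q s (a\<^sup>2 + b\<^sup>2) \<le> q s \<parallel>T\<parallel>\<^sup>2\<close>, the first square at most
  \<open>q\<^sup>2 \<omega>\<^sup>2\<close>, and the second is \<open>s\<^sup>2 (\<parallel>T x\<parallel>\<^sup>2 - a\<^sup>2) \<le> s\<^sup>2 (\<parallel>T\<parallel>\<^sup>2 - c\<^sup>2)\<close>: the Crawford number is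
  a lower bound for \<open>a\<close>, and so limits how much of \<open>T x\<close> can be orthogonal to \<open>x\<close>. The three bounds
  add up to the right-hand side (lemma \<open>cmod_cinner_sq_le\<close>), which does not depend on \<open>x\<close> and \<open>y\<close>,
  so it remains to take the supremum.\<close>

section \<open>Complex inner products\<close>

lemma cinner_add_right: "cinner x (y + z) = cinner x y + cinner x z"
  by (metis cinner_add_left cinner_commute complex_cnj_add)

lemma cinner_scaleC_right: "cinner x (a *\<^sub>C y) = cnj a * cinner x y"
  by (metis cinner_scaleC_left cinner_commute complex_cnj_mult)

lemma minus_eq_scaleC: "- x = (- 1) *\<^sub>C x" for x :: "'a::complex_vector"
  using scaleR_scaleC[of "-1" x] by simp

lemma cinner_diff_left: "cinner (x - y) z = cinner x z - cinner y z"
proof -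
  have "cinner (- y) z = - cinner y z"
    by (subst minus_eq_scaleC) (simp add: cinner_scaleC_left)
  then show ?thesis
    using cinner_add_left[of x "- y" z] by simp
qed

lemma cinner_diff_right: "cinner x (y - z) = cinner x y - cinner x z"
  by (metis cinner_diff_left cinner_commute complex_cnj_diff)

lemma cinner_self: "cinner x x = complex_of_real ((norm x)\<^sup>2)"
proof -
  have "Im (cinner x x) = 0"
    using arg_cong[OF cinner_commute[of x x], of Im] by simp
  then show ?thesis
    by (simp add: complex_eq_iff norm_eq_sqrt_cinner cinner_ge_zero)
qed

lemma cmod_cinner_commute: "cmod (cinner x y) = cmod (cinner y x)"
  by (metis cinner_commute complex_mod_cnj)

text \<open>The map \<open>v \<mapsto> v - \<langle>v,x\<rangle> x\<close> projects orthogonally onto the complement of \<open>x\<close>, so only the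
  contribution of the components parallel to \<open>x\<close> is lost. The case \<open>w = v\<close> is Pythagoras' theorem.\<close>

lemma cinner_residuals:
  assumes "norm x = 1"
  shows "cinner (v - cinner v x *\<^sub>C x) (w - cinner w x *\<^sub>C x)
    = cinner v w - cinner v x * cinner x w"
  using cinner_commute[of x w] assms
  by (simp add: cinner_diff_left cinner_diff_right cinner_scaleC_left cinner_scaleC_right
      cinner_self)

lemma norm_residual_sq:
  assumes "norm x = 1"
  shows "(norm (v - cinner v x *\<^sub>C x))\<^sup>2 = (norm v)\<^sup>2 - (cmod (cinner v x))\<^sup>2"
proof -
  have "complex_of_real ((norm (v - cinner v x *\<^sub>C x))\<^sup>2)
      = cinner v v - cinner v x * cnj (cinner v x)"
    using cinner_residuals[OF assms, of v v] cinner_commute[of x v] by (simp add: cinner_self)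
  also have "\<dots> = complex_of_real ((norm v)\<^sup>2 - (cmod (cinner v x))\<^sup>2)"
    by (simp only: cinner_self complex_norm_square of_real_diff)
  finally show ?thesis
    by (simp only: of_real_eq_iff)
qed

lemma cmod_cinner_le: "cmod (cinner x y) \<le> norm x * norm y"
proof (cases "y = 0")
  case True
  have "cinner x 0 = 0"
    using cinner_diff_right[of x 0 0] by simp
  with True show ?thesis by simp
next
  case False
  define e where "e = (1 / norm y) *\<^sub>R y"
  have e: "norm e = 1"
    using False by (simp add: e_def)
  have y: "y = complex_of_real (norm y) *\<^sub>C e"
    using False by (simp add: e_def flip: scaleR_scaleC)
  have "(cmod (cinner x e))\<^sup>2 \<le> (norm x)\<^sup>2"
    using norm_residual_sq[OF e, of x] zero_le_power2[of "norm (x - cinner x e *\<^sub>C e)"]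
    by linarith
  then have "cmod (cinner x e) \<le> norm x"
    by (rule power2_le_imp_le) simp
  moreover have "cmod (cinner x y) = norm y * cmod (cinner x e)"
    using arg_cong[OF y, of "\<lambda>u. cmod (cinner x u)"] by (simp add: cinner_scaleC_right norm_mult)
  ultimately show ?thesis
    using mult_left_mono[of "cmod (cinner x e)" "norm x" "norm y"] by (simp add: mult.commute)
qed

text \<open>Cauchy--Schwarz is applied to the components of \<open>v\<close> and \<open>w\<close> orthogonal to \<open>x\<close> only, whose norms
  Pythagoras supplies; this is sharper than applying it to \<open>v\<close> and \<open>w\<close> themselves.\<close>

lemma cmod_cinner_split_le:
  assumes "norm x = 1"
  shows "cmod (cinner v w) \<le> cmod (cinner v x) * cmod (cinner w x)
    + sqrt ((norm v)\<^sup>2 - (cmod (cinner v x))\<^sup>2) * sqrt ((norm w)\<^sup>2 - (cmod (cinner w x))\<^sup>2)"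
proof -
  let ?r = "\<lambda>u. u - cinner u x *\<^sub>C x"
  have "cinner v w = cinner v x * cinner x w + cinner (?r v) (?r w)"
    by (simp add: cinner_residuals[OF assms])
  then have "cmod (cinner v w) \<le> cmod (cinner v x * cinner x w) + cmod (cinner (?r v) (?r w))"
    by (metis norm_triangle_ineq)
  also have "\<dots> \<le> cmod (cinner v x) * cmod (cinner w x) + norm (?r v) * norm (?r w)"
    by (simp add: norm_mult cmod_cinner_commute[of x w] cmod_cinner_le)
  finally show ?thesis
    by (simp flip: norm_residual_sq[OF assms])
qed

section \<open>Numerical radius and Crawford number\<close>

lemma norm_apply_le_onorm:
  assumes "bounded_clinear T" and "norm x = 1"
  shows "norm (T x) \<le> onorm T"
  using onorm[of T x] assms by (simp add: bounded_clinear_def)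

lemma cmod_cinner_apply_le_onorm:
  assumes "bounded_clinear T" and "norm x = 1"
  shows "cmod (cinner (T x) x) \<le> onorm T"
  using cmod_cinner_le[of "T x" x] norm_apply_le_onorm[OF assms] assms(2) by simp

lemma cmod_cinner_le_numerical_radius:
  assumes "bounded_clinear T" and "norm x = 1"
  shows "cmod (cinner (T x) x) \<le> numerical_radius T"
proof -
  let ?W = "{cmod (cinner (T x) x) | x. norm x = 1}"
  have x: "cmod (cinner (T x) x) \<in> ?W"
    using assms(2) by blast
  have "bdd_above ?W"
    using cmod_cinner_apply_le_onorm[OF assms(1)] by (auto intro!: bdd_aboveI[of _ "onorm T"])
  then have "cmod (cinner (T x) x) \<le> Sup ?W"
    by (rule cSup_upper[OF x])
  moreover have "numerical_radius T = Sup ?W"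
    unfolding numerical_radius_def Sup0_def using x by (metis empty_iff)
  ultimately show ?thesis by simp
qed

lemma crawford_number_le_cmod_cinner:
  assumes "norm x = 1"
  shows "crawford_number T \<le> cmod (cinner (T x) x)"
proof -
  let ?W = "{cmod (cinner (T x) x) | x. norm x = 1}"
  have x: "cmod (cinner (T x) x) \<in> ?W"
    using assms by blast
  have "bdd_below ?W"
    by (auto intro!: bdd_belowI[of _ 0])
  then have "Inf ?W \<le> cmod (cinner (T x) x)"
    by (rule cInf_lower[OF x])
  moreover have "crawford_number T = Inf ?W"
    unfolding crawford_number_def Inf0_def using x by (metis empty_iff)
  ultimately show ?thesis by simp
qed

lemma crawford_number_nonneg: "0 \<le> crawford_number T"
  unfolding crawford_number_def Inf0_def by (auto intro!: cInf_greatest)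

text \<open>On the zero space the Crawford number is 0 by the convention on empty sets.\<close>

lemma crawford_number_le_onorm:
  fixes T :: "'a::complex_inner \<Rightarrow> 'a"
  assumes "bounded_clinear T"
  shows "crawford_number T \<le> onorm T"
proof (cases "\<exists>x::'a. norm x = 1")
  case True
  then obtain x :: 'a where "norm x = 1" ..
  then show ?thesis
    using crawford_number_le_cmod_cinner[of x T] cmod_cinner_apply_le_onorm[OF assms, of x]
    by linarith
next
  case False
  then have "crawford_number T = 0"
    by (simp add: crawford_number_def Inf0_def)
  then show ?thesis
    using assms onorm_pos_le[of T] by (simp add: bounded_clinear_def)
qed

section \<open>The bound on the q-numerical radius\<close>

lemma cmod_cinner_sq_le:
  assumes T: "bounded_clinear T" and q: "0 \<le> q" "q \<le> 1"
    and x: "norm x = 1" and y: "norm y = 1" and xy: "cinner x y = complex_of_real q"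
  shows "(cmod (cinner (T x) y))\<^sup>2
    \<le> q\<^sup>2 * (numerical_radius T)\<^sup>2
      + (1 - q\<^sup>2 + q * sqrt (1 - q\<^sup>2)) * (onorm T)\<^sup>2
      - (1 - q\<^sup>2) * (crawford_number T)\<^sup>2"
proof -
  define s where "s = sqrt (1 - q\<^sup>2)"
  define a where "a = cmod (cinner (T x) x)"
  define b where "b = sqrt ((norm (T x))\<^sup>2 - a\<^sup>2)"
  have "q\<^sup>2 \<le> 1"
    using q by (simp add: power_le_one)
  then have s: "0 \<le> s" "s\<^sup>2 = 1 - q\<^sup>2"
    by (simp_all add: s_def)
  have "a \<le> norm (T x)"
    using cmod_cinner_le[of "T x" x] x by (simp add: a_def)
  then have "a\<^sup>2 \<le> (norm (T x))\<^sup>2"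
    by (simp add: a_def power_mono)
  then have ab: "a\<^sup>2 + b\<^sup>2 = (norm (T x))\<^sup>2"
    by (simp add: b_def)
  have "cmod (cinner y x) = q"
    using xy q by (simp add: cmod_cinner_commute[of y x])
  then have "cmod (cinner (T x) y) \<le> q * a + s * b"
    using cmod_cinner_split_le[OF x, of "T x" y] y by (simp add: a_def b_def s_def mult.commute)
  then have "(cmod (cinner (T x) y))\<^sup>2 \<le> (q * a + s * b)\<^sup>2"
    by (simp add: power_mono)
  also have "\<dots> = q\<^sup>2 * a\<^sup>2 + (q * s) * (2 * a * b) + s\<^sup>2 * b\<^sup>2"
    by (simp add: power2_eq_square algebra_simps)
  also have "\<dots> \<le> q\<^sup>2 * (numerical_radius T)\<^sup>2 + (q * s) * (onorm T)\<^sup>2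
      + s\<^sup>2 * ((onorm T)\<^sup>2 - (crawford_number T)\<^sup>2)"
  proof -
    have N: "(norm (T x))\<^sup>2 \<le> (onorm T)\<^sup>2"
      using norm_apply_le_onorm[OF T x] by (simp add: power_mono)
    have "a\<^sup>2 \<le> (numerical_radius T)\<^sup>2"
      using cmod_cinner_le_numerical_radius[OF T x] by (simp add: a_def power_mono)
    moreover have "2 * a * b \<le> (onorm T)\<^sup>2"
      using sum_squares_bound[of a b] ab N by linarith
    moreover have "(crawford_number T)\<^sup>2 \<le> a\<^sup>2"
      using crawford_number_le_cmod_cinner[OF x, of T] crawford_number_nonneg[of T]
      by (simp add: a_def power_mono)
    then have "b\<^sup>2 \<le> (onorm T)\<^sup>2 - (crawford_number T)\<^sup>2"
      using ab N by linarith
    ultimately show ?thesis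
      using q s \<open>q\<^sup>2 \<le> 1\<close> by (intro add_mono mult_left_mono) auto
  qed
  also have "\<dots> = q\<^sup>2 * (numerical_radius T)\<^sup>2 + (1 - q\<^sup>2 + q * s) * (onorm T)\<^sup>2
      - (1 - q\<^sup>2) * (crawford_number T)\<^sup>2"
    by (simp add: s algebra_simps)
  finally show ?thesis
    by (simp add: s_def)
qed

theorem theorem2p12:
  fixes T :: "'a::chilbert_space \<Rightarrow> 'a" and q :: real
  assumes "bounded_clinear T"
    and "0 \<le> q" and "q \<le> 1"
  shows "(q_numerical_radius q T)\<^sup>2
    \<le> q\<^sup>2 * (numerical_radius T)\<^sup>2
      + (1 - q\<^sup>2 + q * sqrt (1 - q\<^sup>2)) * (onorm T)\<^sup>2
      - (1 - q\<^sup>2) * (crawford_number T)\<^sup>2" (is "_ \<le> ?B")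
proof -
  let ?S = "{cmod (cinner (T x) y) | x y.
    norm x = 1 \<and> norm y = 1 \<and> cinner x y = complex_of_real q}"
  show ?thesis
  proof (cases "?S = {}")
    case True
    \<comment> \<open>The claim is then that the right-hand side is nonnegative, which holds because the Crawford
      number is at most the operator norm.\<close>
    have q2: "q\<^sup>2 \<le> 1"
      using assms by (simp add: power_le_one)
    have "(crawford_number T)\<^sup>2 \<le> (onorm T)\<^sup>2"
      using crawford_number_le_onorm[OF assms(1)] crawford_number_nonneg[of T]
      by (simp add: power_mono)
    then have "0 \<le> q\<^sup>2 * (numerical_radius T)\<^sup>2 + q * sqrt (1 - q\<^sup>2) * (onorm T)\<^sup>2
        + (1 - q\<^sup>2) * ((onorm T)\<^sup>2 - (crawford_number T)\<^sup>2)"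
      using assms q2 by (intro add_nonneg_nonneg mult_nonneg_nonneg) auto
    also have "\<dots> = ?B"
      by (simp add: algebra_simps)
    finally have "0 \<le> ?B" .
    moreover have "q_numerical_radius q T = 0"
      unfolding q_numerical_radius_def Sup0_def by (simp only: True refl if_True)
    ultimately show ?thesis by simp
  next
    case False
    have le: "r \<le> sqrt ?B" and nonneg: "0 \<le> r" if mem: "r \<in> ?S" for r
    proof -
      obtain x y where r: "r = cmod (cinner (T x) y)" and xy: "norm x = 1" "norm y = 1"
          "cinner x y = complex_of_real q"
        using mem by blast
      show "r \<le> sqrt ?B"
        unfolding r by (rule real_le_rsqrt) (rule cmod_cinner_sq_le[OF assms xy])
      show "0 \<le> r"
        by (simp add: r)
    qed
    obtain r where r: "r \<in> ?S"
      using False by blast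
    have Q: "q_numerical_radius q T = Sup ?S"
      unfolding q_numerical_radius_def Sup0_def by (simp only: False if_False)
    have "Sup ?S \<le> sqrt ?B"
      using False le by (rule cSup_least)
    moreover have "0 \<le> Sup ?S"
      using r nonneg[OF r] bdd_aboveI[OF le] by (rule cSup_upper2)
    ultimately have "(q_numerical_radius q T)\<^sup>2 \<le> (sqrt ?B)\<^sup>2"
      unfolding Q by (rule power_mono)
    moreover have "0 \<le> ?B"
      using order_trans[OF nonneg[OF r] le[OF r]] by (simp only: real_sqrt_ge_0_iff)
    ultimately show ?thesis by simp
  qed
qed

end
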